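(* Let $\pi_q$ be a projective plane of order $q$. Let $A(\pi_q)$ denote the minimum number of queries needed, in the worst case, by an adaptive search to determine an unknown point of $\pi_q$, where each query is either a point or a line of $\pi_q$ and the answer to a query is YES if the unknown point is incident with (for a point query: equal to) the queried element and NO otherwise. Then $A(\pi_q)\le 2q-1$. Moreover, if $q$ is a prime power, then $A(\mathrm{PG}(2,q))=2q-1$; equivalently, $A(3,q)=2q-1$.
   Context: Let $q$ be a prime power, $\mathrm{GF}(q)$ the field with $q$ elements, and $V$ an $n$-dimensional vector space over $\mathrm{GF}(q)$. An unknown $1$-dimensional subspace $\mathbf{v}$ of $V$ is to be found. A query is a subspace $U$ of $V$, and the answer is YES if $\mathbf{v}\le U$ and NO otherwise. $A(n,q)$ denotes the minimum number of queries needed (in the worst case) to determine $\mathbf{v}$ in adaptive search, i.e. each query may depend on the answers to previous queries. $\mathrm{PG}(2,q)$ is the Desarguesian projective plane whose points and lines are the $1$- and $2$-dimensional subspaces of a $3$-dimensional vector space over $\mathrm{GF}(q)$. *)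

theory Defs
  imports Complex_Main "HOL-Library.Extended_Nat" "HOL-Library.Cardinality"
    "HOL-Number_Theory.Prime_Powers"
begin

text \<open>
  A deterministic adaptive strategy is a binary decision tree: in \<open>Ask u s t\<close> the query \<open>u\<close> is asked
  and the search goes on with \<open>s\<close> on the answer YES and with \<open>t\<close> on the answer NO; a leaf announces
  the element found. In what follows \<open>ans x u\<close> is the answer to the query \<open>u\<close> when the unknown
  element is \<open>x\<close>.
\<close>

datatype (outputs: 'x, queries: 'u) strategy =
  Announce 'x
| Ask 'u "('x, 'u) strategy" "('x, 'u) strategy"

primrec outcome :: "('x \<Rightarrow> 'u \<Rightarrow> bool) \<Rightarrow> ('x, 'u) strategy \<Rightarrow> 'x \<Rightarrow> 'x" where
  "outcome ans (Announce y) x = y"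
| "outcome ans (Ask u s t) x = (if ans x u then outcome ans s x else outcome ans t x)"

primrec num_queries :: "('x \<Rightarrow> 'u \<Rightarrow> bool) \<Rightarrow> ('x, 'u) strategy \<Rightarrow> 'x \<Rightarrow> nat" where
  "num_queries ans (Announce y) x = 0"
| "num_queries ans (Ask u s t) x =
     Suc (if ans x u then num_queries ans s x else num_queries ans t x)"

definition determines :: "'x set \<Rightarrow> 'u set \<Rightarrow> ('x \<Rightarrow> 'u \<Rightarrow> bool) \<Rightarrow> ('x, 'u) strategy \<Rightarrow> bool" where
  "determines X Q ans t \<longleftrightarrow> queries t \<subseteq> Q \<and> (\<forall>x\<in>X. outcome ans t x = x)"

text \<open>The value is \<open>\<infinity>\<close> if no strategy determines the unknown element.\<close>

definition adaptive_search_number :: "'x set \<Rightarrow> 'u set \<Rightarrow> ('x \<Rightarrow> 'u \<Rightarrow> bool) \<Rightarrow> enat" where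
  "adaptive_search_number X Q ans =
     (INF t \<in> {t. determines X Q ans t}. SUP x\<in>X. enat (num_queries ans t x))"

locale projective_plane =
  fixes P :: "'p set" and L :: "'l set" and I :: "'p \<Rightarrow> 'l \<Rightarrow> bool"
  assumes unique_line:
      "\<lbrakk>a \<in> P; b \<in> P; a \<noteq> b\<rbrakk> \<Longrightarrow> \<exists>!l. l \<in> L \<and> I a l \<and> I b l"
    and unique_point:
      "\<lbrakk>l \<in> L; m \<in> L; l \<noteq> m\<rbrakk> \<Longrightarrow> \<exists>!a. a \<in> P \<and> I a l \<and> I a m"
    and quadrangle:
      "\<exists>S\<subseteq>P. card S = 4 \<and> (\<forall>l\<in>L. card {a \<in> S. I a l} \<le> 2)"

locale projective_plane_of_order = projective_plane P L I
  for P :: "'p set" and L :: "'l set" and I :: "'p \<Rightarrow> 'l \<Rightarrow> bool" +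
  fixes q :: nat
  assumes card_line: "l \<in> L \<Longrightarrow> card {a \<in> P. I a l} = q + 1"

definition plane_search_number :: "'p set \<Rightarrow> 'l set \<Rightarrow> ('p \<Rightarrow> 'l \<Rightarrow> bool) \<Rightarrow> enat" where
  "plane_search_number P L I =
     adaptive_search_number P (P <+> L)
       (\<lambda>x u. case u of Inl a \<Rightarrow> x = a | Inr l \<Rightarrow> I x l)"

definition subspaces_of_dim ::
    "('k::field \<Rightarrow> 'v::ab_group_add \<Rightarrow> 'v) \<Rightarrow> 'v set \<Rightarrow> nat \<Rightarrow> 'v set set" where
  "subspaces_of_dim scale V k =
     {U. module.subspace scale U \<and> U \<subseteq> V \<and> vector_space.dim scale U = k}"

text \<open>For a 3-dimensional space \<open>V\<close> over \<open>GF(q)\<close> this is \<open>A(PG(2,q))\<close>.\<close>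

definition PG_search_number ::
    "('k::field \<Rightarrow> 'v::ab_group_add \<Rightarrow> 'v) \<Rightarrow> 'v set \<Rightarrow> enat" where
  "PG_search_number scale V =
     plane_search_number (subspaces_of_dim scale V 1) (subspaces_of_dim scale V 2) (\<subseteq>)"

text \<open>For an n-dimensional space \<open>V\<close> over \<open>GF(q)\<close> this is \<open>A(n,q)\<close>; every subspace of \<open>V\<close>,
  including \<open>0\<close> and \<open>V\<close> itself, is a legitimate query.\<close>

definition subspace_search_number ::
    "('k::field \<Rightarrow> 'v::ab_group_add \<Rightarrow> 'v) \<Rightarrow> 'v set \<Rightarrow> enat" where
  "subspace_search_number scale V =
     adaptive_search_number (subspaces_of_dim scale V 1)
       {U. module.subspace scale U \<and> U \<subseteq> V} (\<subseteq>)"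

end

theory Submission imports Defs "HOL-Computational_Algebra.Polynomial" begin

text \<open>
  Upper bound: ask all but one of the lines through a fixed point, which singles out the line through
  the unknown point, and then go through the points of that line.

  Lower bound: an adversary answers NO as long as possible, so the queries asked are subspaces that
  together contain every point except one, \<open>\<langle>e\<rangle>\<close>. Choose linear functionals \<open>f\<^sub>1, \<dots>, f\<^sub>k\<close> that vanish on
  these subspaces and take the value 1 at \<open>e\<close>. On the affine plane \<open>f\<^sub>1 = 1\<close> the product
  \<open>f\<^sub>2 \<cdots> f\<^sub>k\<close> vanishes everywhere except at \<open>e\<close>, so its sum over this plane is nonzero. But
  the sum over \<open>GF(q)\<^sup>2\<close> of a polynomial of degree less than \<open>2(q - 1)\<close> is zero; hence
  \<open>k - 1 \<ge> 2(q - 1)\<close>.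
\<close>

section \<open>Decision trees: explicit strategies and the adversary bound\<close>

section \<open>Strategies\<close>

text \<open>Correctness and worst-case bound are joined in one predicate. \<open>X\<close> is the
  set of candidates still possible: it shrinks with every answer while \<open>Q\<close> and
  \<open>ans\<close> stay fixed, which suits induction.\<close>

definition searchable :: "'u set \<Rightarrow> ('x \<Rightarrow> 'u \<Rightarrow> bool) \<Rightarrow> 'x set \<Rightarrow> nat \<Rightarrow> bool" where
  "searchable Q ans X n \<longleftrightarrow>
     (\<exists>t. queries t \<subseteq> Q \<and> (\<forall>x\<in>X. outcome ans t x = x \<and> num_queries ans t x \<le> n))"

lemma searchable_mono:
  assumes "searchable Q ans X m" "Y \<subseteq> X" "m \<le> n"
  shows "searchable Q ans Y n"
  using assms unfolding searchable_def by (meson order_trans subsetD)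

lemma searchable_singleton:
  assumes "X \<subseteq> {x}"
  shows "searchable Q ans X n"
  unfolding searchable_def using assms by (intro exI[of _ "Announce x"]) auto

lemma searchable_Ask:
  assumes "u \<in> Q" "searchable Q ans {x\<in>X. ans x u} n" "searchable Q ans {x\<in>X. \<not> ans x u} n"
  shows "searchable Q ans X (Suc n)"
proof -
  obtain s where s: "queries s \<subseteq> Q"
    "\<forall>x\<in>{x\<in>X. ans x u}. outcome ans s x = x \<and> num_queries ans s x \<le> n"
    using assms(2) unfolding searchable_def by blast
  obtain t where t: "queries t \<subseteq> Q"
    "\<forall>x\<in>{x\<in>X. \<not> ans x u}. outcome ans t x = x \<and> num_queries ans t x \<le> n"
    using assms(3) unfolding searchable_def by blast
  show ?thesis
    unfolding searchable_def using assms(1) s t by (intro exI[of _ "Ask u s t"]) auto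
qed

text \<open>Each query tests a single candidate. The last candidate left is known without being
  tested, so \<open>Suc n\<close> candidates cost only \<open>n\<close> queries.\<close>

lemma searchable_one_by_one:
  assumes "finite X" "card X \<le> Suc n"
    and "\<And>x. x \<in> X \<Longrightarrow> \<exists>u\<in>Q. \<forall>y\<in>X. ans y u \<longleftrightarrow> y = x"
  shows "searchable Q ans X n"
  using assms
proof (induction n arbitrary: X)
  case 0
  then have "card X = 0 \<or> card X = 1" by linarith
  then obtain x where "X \<subseteq> {x}"
    using 0(1) by (auto simp: card_1_singleton_iff)
  then show ?case by (rule searchable_singleton)
next
  case (Suc n)
  show ?case
  proof (cases "X = {}")
    case True
    then show ?thesis by (intro searchable_singleton) auto
  next
    case False
    then obtain x where x: "x \<in> X" by blast
    then obtain u where u: "u \<in> Q" "\<forall>y\<in>X. ans y u \<longleftrightarrow> y = x"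
      using Suc.prems(3) by blast
    show ?thesis
    proof (rule searchable_Ask[OF u(1)])
      show "searchable Q ans {y\<in>X. ans y u} n"
        using u(2) by (intro searchable_singleton[of _ x]) auto
      have eq: "{y\<in>X. \<not> ans y u} = X - {x}" using u(2) by auto
      show "searchable Q ans {y\<in>X. \<not> ans y u} n"
        unfolding eq
      proof (rule Suc.IH)
        show "card (X - {x}) \<le> Suc n" using Suc.prems(1,2) x by simp
        show "\<exists>u\<in>Q. \<forall>y\<in>X - {x}. ans y u \<longleftrightarrow> y = z" if "z \<in> X - {x}" for z
          using Suc.prems(3)[of z] that by blast
      qed (use Suc.prems(1) in simp)
    qed
  qed
qed

text \<open>Ask the members of \<open>F\<close> in turn until one answers YES, then test its
  candidates one by one. Both phases save their last query: if all members of \<open>F\<close> but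
  one have answered NO, the covering hypothesis makes the last one certain.\<close>

lemma searchable_cover:
  assumes "finite F" "card F \<le> Suc k" "F \<subseteq> Q"
    and "\<And>x. x \<in> X \<Longrightarrow> \<exists>l\<in>F. ans x l"
    and "\<And>l. l \<in> F \<Longrightarrow> finite {x\<in>X. ans x l} \<and> card {x\<in>X. ans x l} \<le> Suc n"
    and "\<And>x. x \<in> X \<Longrightarrow> \<exists>u\<in>Q. \<forall>y\<in>X. ans y u \<longleftrightarrow> y = x"
  shows "searchable Q ans X (k + n)"
  using assms
proof (induction k arbitrary: F X)
  case 0
  then have "card F = 0 \<or> card F = 1" by linarith
  then consider "F = {}" | l where "F = {l}"
    using 0(1) by (auto simp: card_1_singleton_iff)
  then show ?case
  proof cases
    case 1
    then show ?thesis using 0(4) by (intro searchable_singleton) auto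
  next
    case 2
    then have "{x\<in>X. ans x l} = X" using 0(4) by auto
    then have "finite X" "card X \<le> Suc n" using 0(5)[of l] 2 by auto
    then show ?thesis using 0(6) by (simp add: searchable_one_by_one)
  qed
next
  case (Suc k)
  show ?case
  proof (cases "F = {}")
    case True
    then show ?thesis using Suc.prems(4) by (intro searchable_singleton) auto
  next
    case False
    then obtain l where l: "l \<in> F" by blast
    have "searchable Q ans X (Suc (k + n))"
    proof (rule searchable_Ask)
      show "l \<in> Q" using l Suc.prems(3) by blast
      have "searchable Q ans {x\<in>X. ans x l} n"
      proof (rule searchable_one_by_one)
        show "\<exists>u\<in>Q. \<forall>y\<in>{x\<in>X. ans x l}. ans y u \<longleftrightarrow> y = x" if "x \<in> {x\<in>X. ans x l}" for x
          using Suc.prems(6)[of x] that by blast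
      qed (use Suc.prems(5)[OF l] in auto)
      then show "searchable Q ans {x\<in>X. ans x l} (k + n)"
        by (rule searchable_mono) auto
      show "searchable Q ans {x\<in>X. \<not> ans x l} (k + n)"
      proof (rule Suc.IH[of "F - {l}"])
        show "card (F - {l}) \<le> Suc k" using Suc.prems(1,2) l by simp
        show "\<exists>m\<in>F - {l}. ans x m" if "x \<in> {x\<in>X. \<not> ans x l}" for x
          using Suc.prems(4)[of x] that by auto
        show "\<exists>u\<in>Q. \<forall>y\<in>{x\<in>X. \<not> ans x l}. ans y u \<longleftrightarrow> y = x" if "x \<in> {x\<in>X. \<not> ans x l}" for x
          using Suc.prems(6)[of x] that by blast
        show "finite {x\<in>{x\<in>X. \<not> ans x l}. ans x m} \<and> card {x\<in>{x\<in>X. \<not> ans x l}. ans x m} \<le> Suc n"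
          if "m \<in> F - {l}" for m
        proof -
          have sub: "{x\<in>{x\<in>X. \<not> ans x l}. ans x m} \<subseteq> {x\<in>X. ans x m}" by blast
          have fin: "finite {x\<in>X. ans x m}" and le: "card {x\<in>X. ans x m} \<le> Suc n"
            using Suc.prems(5)[of m] that by auto
          show ?thesis
            using finite_subset[OF sub fin] card_mono[OF fin sub] le by simp
        qed
      qed (use Suc.prems(1,3) in auto)
    qed
    then show ?thesis by simp
  qed
qed

lemma adaptive_search_number_le:
  assumes "searchable Q ans X n"
  shows "adaptive_search_number X Q ans \<le> enat n"
proof -
  obtain t where t: "queries t \<subseteq> Q" "\<forall>x\<in>X. outcome ans t x = x \<and> num_queries ans t x \<le> n"
    using assms unfolding searchable_def by blast
  then show ?thesis
    unfolding adaptive_search_number_def determines_def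
    by (intro INF_lower2[of t] SUP_least) auto
qed

text \<open>A NO to the first line of the pencil also rules out its centre \<open>p\<close>, so that every further line
  accounts for only \<open>q\<close> candidates.\<close>

lemma adaptive_search_number_pencil_le:
  assumes "2 \<le> q" and F: "finite F" "F \<noteq> {}" "card F \<le> Suc q" "F \<subseteq> Q"
    and centre: "\<And>l. l \<in> F \<Longrightarrow> ans p l"
    and cover: "\<And>x. x \<in> X \<Longrightarrow> x \<noteq> p \<Longrightarrow> \<exists>l\<in>F. ans x l"
    and line: "\<And>l. l \<in> F \<Longrightarrow> finite {x\<in>X. x \<noteq> p \<and> ans x l} \<and> card {x\<in>X. x \<noteq> p \<and> ans x l} \<le> q"
    and point: "\<And>x. x \<in> X \<Longrightarrow> \<exists>u\<in>Q. \<forall>y\<in>X. ans y u \<longleftrightarrow> y = x"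
  shows "adaptive_search_number X Q ans \<le> enat (2 * q - 1)"
proof (rule adaptive_search_number_le)
  obtain l where l: "l \<in> F" using F(2) by blast
  have "searchable Q ans X (Suc (2 * q - 2))"
  proof (rule searchable_Ask)
    show "l \<in> Q" using l F(4) by blast
    have "searchable Q ans {x\<in>X. ans x l} q"
    proof (rule searchable_one_by_one)
      have sub: "{x\<in>X. ans x l} \<subseteq> insert p {x\<in>X. x \<noteq> p \<and> ans x l}" by blast
      have fin: "finite (insert p {x\<in>X. x \<noteq> p \<and> ans x l})" using line[OF l] by simp
      show "finite {x\<in>X. ans x l}" using finite_subset[OF sub fin] .
      have "card {x\<in>X. ans x l} \<le> card (insert p {x\<in>X. x \<noteq> p \<and> ans x l})"
        using card_mono[OF fin sub] .
      also have "\<dots> \<le> Suc q" using line[OF l] by simp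
      finally show "card {x\<in>X. ans x l} \<le> Suc q" .
      show "\<exists>u\<in>Q. \<forall>y\<in>{x\<in>X. ans x l}. ans y u \<longleftrightarrow> y = x" if "x \<in> {x\<in>X. ans x l}" for x
        using point[of x] that by blast
    qed
    \<comment> \<open>The YES branch still contains \<open>p\<close> and costs \<open>q\<close>
      queries; this fits the budget because \<open>2 <= q\<close>.\<close>
    then show "searchable Q ans {x\<in>X. ans x l} (2 * q - 2)"
      by (rule searchable_mono) (use \<open>2 \<le> q\<close> in auto)
    \<comment> \<open>At most \<open>q\<close> members of \<open>F\<close> remain, each with at most
      \<open>q\<close> candidates; \<open>searchable_cover\<close> saves one query on either
      count.\<close>
    have "searchable Q ans {x\<in>X. \<not> ans x l} ((q - 1) + (q - 1))"
    proof (rule searchable_cover[of "F - {l}"])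
      show "card (F - {l}) \<le> Suc (q - 1)" using F(1,3) l \<open>2 \<le> q\<close> by simp
      show "\<exists>m\<in>F - {l}. ans x m" if "x \<in> {x\<in>X. \<not> ans x l}" for x
        using cover[of x] centre[OF l] that by auto
      show "\<exists>u\<in>Q. \<forall>y\<in>{x\<in>X. \<not> ans x l}. ans y u \<longleftrightarrow> y = x" if "x \<in> {x\<in>X. \<not> ans x l}" for x
        using point[of x] that by blast
      show "finite {x\<in>{x\<in>X. \<not> ans x l}. ans x m} \<and>
          card {x\<in>{x\<in>X. \<not> ans x l}. ans x m} \<le> Suc (q - 1)" if "m \<in> F - {l}" for m
      proof -
        have sub: "{x\<in>{x\<in>X. \<not> ans x l}. ans x m} \<subseteq> {x\<in>X. x \<noteq> p \<and> ans x m}"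
          using centre[OF l] by auto
        have fin: "finite {x\<in>X. x \<noteq> p \<and> ans x m}" and le: "card {x\<in>X. x \<noteq> p \<and> ans x m} \<le> q"
          using line[of m] that by auto
        show ?thesis
          using finite_subset[OF sub fin] card_mono[OF fin sub] le by simp
      qed
    qed (use F in auto)
    then show "searchable Q ans {x\<in>X. \<not> ans x l} (2 * q - 2)"
      by (rule searchable_mono) auto
  qed
  then show "searchable Q ans X (2 * q - 1)"
    by (rule searchable_mono) (use \<open>2 \<le> q\<close> in auto)
qed

text \<open>Renaming the queries of a decision tree along \<open>f\<close> changes neither its
  outcome nor its depth on \<open>X\<close>, so every strategy for \<open>Q\<close> becomes one for
  \<open>Q'\<close>.\<close>

lemma adaptive_search_number_map_queries:
  assumes "f ` Q \<subseteq> Q'" and ans: "\<And>x u. x \<in> X \<Longrightarrow> u \<in> Q \<Longrightarrow> ans' x (f u) \<longleftrightarrow> ans x u"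
  shows "adaptive_search_number X Q' ans' \<le> adaptive_search_number X Q ans"
  unfolding adaptive_search_number_def
proof (rule INF_mono)
  fix t assume "t \<in> {t. determines X Q ans t}"
  then have t: "queries t \<subseteq> Q" "\<forall>x\<in>X. outcome ans t x = x"
    unfolding determines_def by auto
  have same: "outcome ans' (map_strategy id f t) x = outcome ans t x \<and>
      num_queries ans' (map_strategy id f t) x = num_queries ans t x"
    if "x \<in> X" for x
    using t(1) by (induction t) (auto simp: ans[OF that])
  show "\<exists>s\<in>{t. determines X Q' ans' t}.
      (SUP x\<in>X. enat (num_queries ans' s x)) \<le> (SUP x\<in>X. enat (num_queries ans t x))"
  proof (rule bexI[of _ "map_strategy id f t"])
    show "map_strategy id f t \<in> {t. determines X Q' ans' t}"
      using t assms(1) same by (auto simp: determines_def strategy.set_map)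
    show "(SUP x\<in>X. enat (num_queries ans' (map_strategy id f t) x)) \<le>
        (SUP x\<in>X. enat (num_queries ans t x))"
      using same by (intro SUP_mono) force
  qed
qed

text \<open>Follow the answer NO as long as it leaves a candidate. A query for which it does not is
  answered YES by all remaining candidates and can be dropped.\<close>

lemma determines_imp_isolating_queries:
  assumes "determines X Q ans t" "X \<noteq> {}"
  shows "\<exists>x\<in>X. \<exists>us. set us \<subseteq> Q \<and> length us \<le> num_queries ans t x \<and>
           {y\<in>X. \<forall>u\<in>set us. \<not> ans y u} = {x}"
  using assms
proof (induction t arbitrary: X)
  case (Announce y)
  then have "X = {y}" by (auto simp: determines_def)
  then show ?case by (intro bexI[of _ y] exI[of _ "[]"]) auto
next
  case (Ask u s t)
  show ?case
  proof (cases "\<exists>x\<in>X. \<not> ans x u")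
    case True
    let ?Y = "{x\<in>X. \<not> ans x u}"
    have "determines ?Y Q ans t" using Ask.prems(1) by (auto simp: determines_def)
    then obtain x us where x: "x \<in> ?Y" and us: "set us \<subseteq> Q" "length us \<le> num_queries ans t x"
      "{y\<in>?Y. \<forall>u\<in>set us. \<not> ans y u} = {x}"
      using Ask.IH(2)[of ?Y] True by blast
    have "u \<in> Q" using Ask.prems(1) by (auto simp: determines_def)
    moreover have "{y\<in>X. \<forall>v\<in>set (u # us). \<not> ans y v} = {x}"
      unfolding us(3)[symmetric] by auto
    ultimately show ?thesis
      using x us(1,2) by (intro bexI[of _ x] exI[of _ "u # us"]) auto
  next
    case False
    then have "determines X Q ans s" using Ask.prems(1) by (auto simp: determines_def)
    then obtain x us where x: "x \<in> X" and us: "set us \<subseteq> Q" "length us \<le> num_queries ans s x"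
      "{y\<in>X. \<forall>u\<in>set us. \<not> ans y u} = {x}"
      using Ask.IH(1)[of X] Ask.prems(2) by blast
    then show ?thesis using False by (intro bexI[of _ x] exI[of _ us]) auto
  qed
qed

text \<open>Reduces adaptive search to a static covering problem: the NO path of any correct tree
  yields queries that together answer YES for all candidates but one, and there are at most as many
  of them as the tree asks about that candidate.\<close>

lemma adaptive_search_number_ge:
  assumes "X \<noteq> {}"
    and "\<And>x us. x \<in> X \<Longrightarrow> set us \<subseteq> Q \<Longrightarrow> {y\<in>X. \<forall>u\<in>set us. \<not> ans y u} = {x} \<Longrightarrow> n \<le> length us"
  shows "enat n \<le> adaptive_search_number X Q ans"
  unfolding adaptive_search_number_def
proof (rule INF_greatest)
  fix t assume "t \<in> {t. determines X Q ans t}"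
  then obtain x us where "x \<in> X" "set us \<subseteq> Q" "length us \<le> num_queries ans t x"
    "{y\<in>X. \<forall>u\<in>set us. \<not> ans y u} = {x}"
    using determines_imp_isolating_queries[of X Q ans t] assms(1) by blast
  with assms(2)[of x us] have "enat n \<le> enat (num_queries ans t x)" by simp
  also have "\<dots> \<le> (SUP x\<in>X. enat (num_queries ans t x))"
    using \<open>x \<in> X\<close> by (rule SUP_upper)
  finally show "enat n \<le> (SUP x\<in>X. enat (num_queries ans t x))" .
qed

section \<open>The upper bound for an arbitrary plane of order \<open>q\<close>\<close>

section \<open>Projective planes\<close>

lemma (in projective_plane) line_eqI:
  assumes "a \<in> P" "b \<in> P" "a \<noteq> b" "l \<in> L" "m \<in> L" "I a l" "I b l" "I a m" "I b m"
  shows "l = m"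
  using unique_line[of a b] assms by blast

text \<open>The three excluded triples serve the pencil argument: the first keeps \<open>a\<close>
  off the line \<open>bc\<close>, the other two keep the intersection of \<open>ad\<close> and
  \<open>bc\<close> away from \<open>b\<close> and \<open>c\<close>.\<close>

lemma (in projective_plane) obtain_quadrangle:
  obtains a b c d where "a \<in> P" "b \<in> P" "c \<in> P" "d \<in> P" "distinct [a, b, c, d]"
    "\<And>l. l \<in> L \<Longrightarrow> \<not> (I a l \<and> I b l \<and> I c l)" "\<And>l. l \<in> L \<Longrightarrow> \<not> (I a l \<and> I d l \<and> I b l)"
    "\<And>l. l \<in> L \<Longrightarrow> \<not> (I a l \<and> I d l \<and> I c l)"
proof -
  obtain S where S: "S \<subseteq> P" "card S = 4" "\<forall>l\<in>L. card {a\<in>S. I a l} \<le> 2"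
    using quadrangle by blast
  then obtain xs where xs: "set xs = S" "distinct xs"
    by (metis card.infinite finite_distinct_list zero_neq_numeral)
  then have "length xs = 4" using S(2) distinct_card by fastforce
  then obtain a b c d where abcd: "xs = [a, b, c, d]"
    by (auto simp: numeral_eq_Suc length_Suc_conv)
  have no3: "\<not> (I x l \<and> I y l \<and> I z l)"
    if "l \<in> L" "x \<in> S" "y \<in> S" "z \<in> S" "x \<noteq> y" "y \<noteq> z" "x \<noteq> z" for x y z l
  proof
    assume "I x l \<and> I y l \<and> I z l"
    then have "card {x, y, z} \<le> card {a\<in>S. I a l}"
      using that xs(1) by (intro card_mono) auto
    moreover have "card {x, y, z} = 3" using that by simp
    ultimately show False using S(3) \<open>l \<in> L\<close> by fastforce
  qed
  have dist: "distinct [a, b, c, d]" and mem: "a \<in> S" "b \<in> S" "c \<in> S" "d \<in> S"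
    using xs abcd by auto
  show thesis
  proof (rule that[of a b c d])
    fix l assume "l \<in> L"
    then show "\<not> (I a l \<and> I b l \<and> I c l)" "\<not> (I a l \<and> I d l \<and> I b l)" "\<not> (I a l \<and> I d l \<and> I c l)"
      using no3[of l a b c] no3[of l a d b] no3[of l a d c] mem dist by auto
  qed (use S(1) mem dist in blast)+
qed

text \<open>The pencil strategy is applied at the point \<open>a\<close> of a quadrangle. Sending
  each line through \<open>a\<close> to its intersection with the line \<open>m\<close> through
  \<open>b\<close> and \<open>c\<close> is injective, so there are at most \<open>q + 1\<close> such
  lines.\<close>

lemma plane_search_number_le:
  fixes P :: "'p set" and L :: "'l set"
  assumes "projective_plane_of_order P L I q"
  shows "plane_search_number P L I \<le> enat (2 * q - 1)"
proof -
  interpret projective_plane_of_order P L I q by fact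
  obtain a b c d where quad: "a \<in> P" "b \<in> P" "c \<in> P" "d \<in> P" "distinct [a, b, c, d]"
    "\<And>l. l \<in> L \<Longrightarrow> \<not> (I a l \<and> I b l \<and> I c l)" "\<And>l. l \<in> L \<Longrightarrow> \<not> (I a l \<and> I d l \<and> I b l)"
    "\<And>l. l \<in> L \<Longrightarrow> \<not> (I a l \<and> I d l \<and> I c l)"
    by (rule obtain_quadrangle) blast
  obtain m where m: "m \<in> L" "I b m" "I c m" using unique_line[of b c] quad(2,3,5) by auto
  obtain n where n: "n \<in> L" "I a n" "I d n" using unique_line[of a d] quad(1,4,5) by auto
  have am: "\<not> I a m" using quad(6) m by blast
  \<comment> \<open>The cardinality \<open>q + 1\<close> is not 0, the value of \<open>card\<close>
    on infinite sets.\<close>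
  have fin: "finite {x\<in>P. I x l}" if "l \<in> L" for l
    using card_line[OF that] by (metis Suc_eq_plus1 card.infinite nat.distinct(1))
  \<comment> \<open>The diagonal point \<open>z\<close>, where \<open>ad\<close> meets
    \<open>bc\<close>, is a third point of \<open>m\<close> besides \<open>b\<close> and
    \<open>c\<close>.\<close>
  have "2 \<le> q"
  proof -
    obtain z where z: "z \<in> P" "I z m" "I z n" using unique_point[of m n] m n am by auto
    have "z \<noteq> b" "z \<noteq> c" using quad(7,8)[OF n(1)] n z by auto
    then have "card {z, b, c} = 3" using quad(5) by simp
    moreover have "card {z, b, c} \<le> card {x\<in>P. I x m}"
      using fin[OF m(1)] z quad(2,3) m by (intro card_mono) auto
    ultimately show ?thesis using card_line[OF m(1)] by simp
  qed
  define F where "F = {l\<in>L. I a l}"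
  have "\<exists>z. z \<in> P \<and> I z l \<and> I z m" if "l \<in> F" for l
    using unique_point[of l m] m am that by (auto simp: F_def)
  then obtain h where h: "\<And>l. l \<in> F \<Longrightarrow> h l \<in> P \<and> I (h l) l \<and> I (h l) m" by metis
  \<comment> \<open>Both lines join \<open>a\<close> to \<open>h l\<close>; these points differ
    because \<open>h l\<close> lies on \<open>m\<close> and \<open>a\<close> does not.\<close>
  have inj: "inj_on h F"
  proof (rule inj_onI)
    fix l l' assume l: "l \<in> F" "l' \<in> F" "h l = h l'"
    then show "l = l'"
      using line_eqI[of a "h l" l l'] h[of l] h[of l'] am quad(1) by (auto simp: F_def)
  qed
  have img: "h ` F \<subseteq> {x\<in>P. I x m}" using h by auto
  have "finite F" using inj img fin[OF m(1)] by (meson inj_on_finite)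
  have "card F \<le> Suc q"
    using card_inj_on_le[OF inj img fin[OF m(1)]] card_line[OF m(1)] by simp
  show ?thesis
    unfolding plane_search_number_def
  proof (rule adaptive_search_number_pencil_le[where F = "Inr ` F" and p = a])
    show "card (Inr ` F :: ('p + 'l) set) \<le> Suc q"
      using \<open>card F \<le> Suc q\<close> by (simp add: card_image)
    show "Inr ` F \<noteq> ({} :: ('p + 'l) set)" using n by (auto simp: F_def)
    show "\<exists>l\<in>Inr ` F. case l of Inl a \<Rightarrow> x = a | Inr l \<Rightarrow> I x l" if "x \<in> P" "x \<noteq> a" for x
      using unique_line[of x a] that quad(1) by (auto simp: F_def)
    show "finite {x\<in>P. x \<noteq> a \<and> (case l of Inl a \<Rightarrow> x = a | Inr l \<Rightarrow> I x l)} \<and>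
        card {x\<in>P. x \<noteq> a \<and> (case l of Inl a \<Rightarrow> x = a | Inr l \<Rightarrow> I x l)} \<le> q"
      if l: "l \<in> Inr ` F" for l
    proof -
      obtain k where k: "l = Inr k" "k \<in> L" "I a k" using l by (auto simp: F_def)
      have "{x\<in>P. x \<noteq> a \<and> (case l of Inl a \<Rightarrow> x = a | Inr l \<Rightarrow> I x l)} = {x\<in>P. I x k} - {a}"
        using k(1) by auto
      then show ?thesis using fin[OF k(2)] card_line[OF k(2)] k(3) quad(1) by simp
    qed
    show "\<exists>u\<in>P <+> L. \<forall>y\<in>P. (case u of Inl a \<Rightarrow> y = a | Inr l \<Rightarrow> I y l) \<longleftrightarrow> y = x" if "x \<in> P" for x
      using that by (intro bexI[of _ "Inl x"]) auto
  qed (use \<open>2 \<le> q\<close> \<open>finite F\<close> in \<open>auto simp: F_def\<close>)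
qed

section \<open>Covering all points of an affine plane except the origin\<close>

section \<open>Power sums over a finite field\<close>

text \<open>For \<open>r > 0\<close> the polynomial \<open>X^r - 1\<close> has at most
  \<open>r\<close> roots, so some nonzero \<open>g\<close> has \<open>g^r\<close> different from 1.
  Substituting \<open>g * u\<close> for \<open>u\<close> multiplies the sum by \<open>g^r\<close>
  without changing it.\<close>

lemma sum_power_eq_0:
  assumes fin: "finite (UNIV :: 'k::field set)" and r: "r < CARD('k) - 1"
  shows "(\<Sum>u\<in>UNIV. u ^ r :: 'k) = 0"
proof (cases "r = 0")
  case True
  \<comment> \<open>For \<open>r = 0\<close> every summand is 1, also at \<open>u = 0\<close>.
    Comparing the sum of all elements with its translate by 1 shows that these ones add up to
    0.\<close>
  have "(\<Sum>u\<in>UNIV. u :: 'k) = (\<Sum>u\<in>UNIV. u + 1)"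
    by (rule sum.reindex_bij_witness[of _ "\<lambda>u. u + 1" "\<lambda>u. u - 1"]) auto
  then have "(\<Sum>u\<in>(UNIV :: 'k set). 1 :: 'k) = 0" by (simp add: sum.distrib)
  then show ?thesis using True by simp
next
  case False
  let ?p = "monom 1 r - 1 :: 'k poly"
  have p: "coeff ?p r = 1" using False by simp
  then have "?p \<noteq> 0" by (metis coeff_0 zero_neq_one)
  have deg: "degree ?p \<le> r"
    by (intro degree_diff_le) (auto simp: degree_monom_le)
  have "\<exists>g::'k. g \<noteq> 0 \<and> g ^ r \<noteq> 1"
  proof (rule ccontr)
    assume "\<not> ?thesis"
    then have "UNIV - {0} \<subseteq> {x. poly ?p x = 0}" by (auto simp: poly_monom)
    then have "card (UNIV - {0 :: 'k}) \<le> card {x. poly ?p x = 0}"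
      using poly_roots_finite[OF \<open>?p \<noteq> 0\<close>] by (intro card_mono)
    also have "\<dots> \<le> r" using card_poly_roots_bound[OF \<open>?p \<noteq> 0\<close>] deg by linarith
    finally show False using r fin by simp
  qed
  then obtain g :: 'k where g: "g \<noteq> 0" "g ^ r \<noteq> 1" by blast
  have "(\<Sum>u\<in>UNIV. u ^ r :: 'k) = (\<Sum>u\<in>UNIV. (g * u) ^ r)"
    by (rule sum.reindex_bij_witness[of _ "\<lambda>u. g * u" "\<lambda>u. u / g"]) (use g in auto)
  also have "\<dots> = g ^ r * (\<Sum>u\<in>UNIV. u ^ r)"
    by (simp add: power_mult_distrib sum_distrib_left)
  finally show ?thesis using g(2) by (simp add: eq_commute[of _ "_ * _"])
qed

text \<open>The monomial \<open>u^r * w^s\<close> is an accumulator: multiplying out one affine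
  factor shortens the list and raises \<open>r + s\<close> by at most 1, so the degree bound
  persists. When the list is empty, one of the exponents is below \<open>CARD('k) - 1\<close> and
  its power sum vanishes.\<close>

lemma sum_prod_affine_eq_0:
  fixes a b c :: "'i \<Rightarrow> 'k::field"
  assumes fin: "finite (UNIV :: 'k set)" and "r + s + length is < 2 * (CARD('k) - 1)"
  shows "(\<Sum>u\<in>UNIV. \<Sum>w\<in>UNIV. u ^ r * w ^ s * (\<Prod>i\<leftarrow>is. a i * u + b i * w + c i)) = 0"
  using assms(2)
proof (induction "is" arbitrary: r s)
  case Nil
  have "(\<Sum>u\<in>UNIV. \<Sum>w\<in>UNIV. u ^ r * w ^ s) = (\<Sum>u\<in>UNIV. u ^ r :: 'k) * (\<Sum>w\<in>UNIV. w ^ s)"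
    by (simp add: sum_product)
  also have "\<dots> = 0"
  proof (cases "r < CARD('k) - 1")
    case False
    then have "s < CARD('k) - 1" using Nil by simp
    then show ?thesis using sum_power_eq_0[OF fin] by simp
  qed (use sum_power_eq_0[OF fin] in simp)
  finally show ?case by simp
next
  case (Cons i "is")
  let ?S = "\<lambda>r s. \<Sum>u\<in>UNIV. \<Sum>w\<in>UNIV. u ^ r * w ^ s * (\<Prod>i\<leftarrow>is. a i * u + b i * w + c i)"
  have "(\<Sum>u\<in>UNIV. \<Sum>w\<in>UNIV. u ^ r * w ^ s * (\<Prod>i\<leftarrow>i # is. a i * u + b i * w + c i)) =
      a i * ?S (Suc r) s + b i * ?S r (Suc s) + c i * ?S r s"
    by (simp add: sum_distrib_left flip: sum.distrib) (simp add: algebra_simps)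
  also have "\<dots> = 0"
    using Cons.IH[of "Suc r" s] Cons.IH[of r "Suc s"] Cons.IH[of r s] Cons.prems by simp
  finally show ?case .
qed

text \<open>The product of the affine factors is zero away from the origin and nonzero there, so its
  sum over the plane is nonzero; by \<open>sum_prod_affine_eq_0\<close> its factors cannot be
  fewer.\<close>

corollary length_ge_if_prod_affine_isolates_0:
  fixes a b c :: "'i \<Rightarrow> 'k::field"
  assumes fin: "finite (UNIV :: 'k set)"
    and "\<And>i. i \<in> set is \<Longrightarrow> c i \<noteq> 0"
    and "\<And>u w. (u, w) \<noteq> (0, 0) \<Longrightarrow> \<exists>i\<in>set is. a i * u + b i * w + c i = 0"
  shows "2 * (CARD('k) - 1) \<le> length is"
proof (rule ccontr)
  let ?F = "\<lambda>u w. \<Prod>i\<leftarrow>is. a i * u + b i * w + c i"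
  assume "\<not> ?thesis"
  then have "(\<Sum>u\<in>UNIV. \<Sum>w\<in>UNIV. ?F u w) = 0"
    using sum_prod_affine_eq_0[OF fin, of 0 0 "is" a b c] by simp
  moreover have "?F u w = 0" if "(u, w) \<noteq> (0, 0)" for u w
    using assms(3)[OF that] by (force simp: prod_list_zero_iff)
  \<comment> \<open>The conditionals are nested in the order of summation, so that
    \<open>sum.delta\<close> collapses first the sum over \<open>w\<close> and then the one over
    \<open>u\<close>.\<close>
  then have F: "?F u w = (if w = 0 then if u = 0 then ?F 0 0 else 0 else 0)" for u w
    by (cases "u = 0"; cases "w = 0") (simp_all only: if_True if_False prod.inject simp_thms)
  have "(\<Sum>u\<in>UNIV. \<Sum>w\<in>UNIV. ?F u w) =
      (\<Sum>u\<in>(UNIV :: 'k set). \<Sum>w\<in>(UNIV :: 'k set). if w = 0 then if u = 0 then ?F 0 0 else 0 else 0)"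
    by (rule sum.cong[OF refl], rule sum.cong[OF refl], rule F)
  then have "(\<Sum>u\<in>UNIV. \<Sum>w\<in>UNIV. ?F u w) = ?F 0 0"
    using fin by (simp only: sum.delta UNIV_I if_True)
  ultimately show False using assms(2) by (auto simp: prod_list_zero_iff)
qed

section \<open>Functionals, coordinates and the polynomial lower bound\<close>

section \<open>Subspaces of a three-dimensional space\<close>

context vector_space
begin

text \<open>The functional is the coordinate at \<open>e\<close> in a basis of the whole space that
  extends \<open>e\<close> together with a basis of \<open>U\<close>.\<close>

lemma functional_separating_subspace:
  assumes "subspace U" "e \<notin> U"
  obtains f where "\<And>x y. f (x + y) = f x + f y" "\<And>c x. f (scale c x) = c * f x"
    "\<And>x. x \<in> U \<Longrightarrow> f x = 0" "f e = 1"
proof -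
  obtain B where B: "B \<subseteq> U" "independent B" "U \<subseteq> span B" "card B = dim U"
    using basis_exists[of U] by blast
  then have "span B = U" using assms(1) by (simp add: span_subspace)
  then have ind: "independent (insert e B)" using B(2) assms(2) by (simp add: independent_insert)
  define C where "C = extend_basis (insert e B)"
  have C: "independent C" "span C = UNIV" "insert e B \<subseteq> C"
    unfolding C_def using ind
    using extend_basis_superset[OF ind] by (simp_all add: independent_extend_basis span_extend_basis)
  show thesis
  proof (rule that[of "\<lambda>v. representation C v e"])
    fix x assume "x \<in> U"
    \<comment> \<open>The expansion of \<open>x\<close> uses only vectors of \<open>B\<close>, and
      \<open>e\<close> is not among them since \<open>B\<close> lies in \<open>U\<close>.\<close>
    then have "representation C x e = representation B x e"
      using C \<open>span B = U\<close> by (subst representation_extend[of C x B]) auto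
    then show "representation C x e = 0"
      using representation_ne_zero[of B x e] B(1) assms(2) by auto
  qed (use C in \<open>auto simp: representation_add representation_scale representation_basis\<close>)
qed

lemma subspaces_of_dim_1_iff:
  assumes "subspace V"
  shows "U \<in> subspaces_of_dim scale V 1 \<longleftrightarrow> (\<exists>v\<in>V. v \<noteq> 0 \<and> U = span {v})"
proof
  assume "U \<in> subspaces_of_dim scale V 1"
  then have U: "subspace U" "U \<subseteq> V" "dim U = 1" by (auto simp: subspaces_of_dim_def)
  obtain B where B: "B \<subseteq> U" "independent B" "U \<subseteq> span B" "card B = dim U"
    using basis_exists[of U] by blast
  then obtain v where "B = {v}" using U(3) by (auto simp: card_1_singleton_iff)
  then show "\<exists>v\<in>V. v \<noteq> 0 \<and> U = span {v}"
    using B U span_subspace[of B U] by (intro bexI[of _ v]) auto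
next
  assume "\<exists>v\<in>V. v \<noteq> 0 \<and> U = span {v}"
  then obtain v where v: "v \<in> V" "v \<noteq> 0" "U = span {v}" by blast
  moreover have "span {v} \<subseteq> V" using v(1) assms by (simp add: span_minimal)
  moreover have "dim (span {v}) = 1"
    using v(2) by (subst dim_span_eq_card_independent) auto
  ultimately show "U \<in> subspaces_of_dim scale V 1" by (auto simp: subspaces_of_dim_def)
qed

lemma span_singleton_subset_imp_eq:
  assumes "v \<noteq> 0" "span {v} \<subseteq> span {w}"
  shows "span {v} = span {w}"
proof -
  have "v \<in> span {w}" using assms(2) span_base[of v "{v}"] by blast
  then obtain c where c: "v = scale c w" by (auto simp: span_singleton)
  then have "w = scale (inverse c) v" using assms(1) by auto
  then have "w \<in> span {v}" by (metis span_base span_scale singletonI)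
  then show ?thesis using assms(2) by (simp add: span_minimal subset_antisym)
qed

text \<open>Reconciles the two readings of a point query: equality in the plane, containment in the
  search by subspaces.\<close>

lemma subspaces_of_dim_1_subset_iff:
  assumes "subspace V" "x \<in> subspaces_of_dim scale V 1" "y \<in> subspaces_of_dim scale V 1"
  shows "x \<subseteq> y \<longleftrightarrow> x = y"
proof -
  obtain v w where "v \<noteq> 0" "x = span {v}" "y = span {w}"
    using assms(2,3) unfolding subspaces_of_dim_1_iff[OF assms(1)] by blast
  then show ?thesis using span_singleton_subset_imp_eq by blast
qed

lemma span2_iff: "x \<in> span {a, b} \<longleftrightarrow> (\<exists>s t. x = scale s a + scale t b)"
proof
  assume "x \<in> span {a, b}"
  then obtain s t where "x - scale s a = scale t b"
    by (auto simp: span_insert[of a] span_singleton)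
  then have "x = scale s a + scale t b" by (simp add: algebra_simps)
  then show "\<exists>s t. x = scale s a + scale t b" by blast
qed (auto intro: span_add span_scale span_base)

text \<open>A basis \<open>e\<close>, \<open>b\<close>, \<open>c\<close> in coordinate form, so that
  later arguments can compare three coefficients directly.\<close>

lemma extend_to_basis3:
  assumes "subspace V" "dim V = 3" "e \<in> V" "e \<noteq> 0"
  obtains b c where "b \<in> V" "c \<in> V"
    "\<And>v. v \<in> V \<Longrightarrow> \<exists>r s t. v = scale r e + scale s b + scale t c"
    "\<And>r s t. scale r e + scale s b + scale t c = 0 \<Longrightarrow> r = 0 \<and> s = 0 \<and> t = 0"
proof -
  obtain B where B: "{e} \<subseteq> B" "B \<subseteq> V" "independent B" "V \<subseteq> span B"
    using maximal_independent_subset_extend[of "{e}" V] assms(3,4) by auto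
  then have "card B = 3" using assms(2) by (metis basis_card_eq_dim)
  then have "card (B - {e}) = 2" using B(1) card.infinite by fastforce
  then obtain b c where bc: "B - {e} = {b, c}" "b \<noteq> c" by (auto simp: card_2_iff)
  then have Beq: "B = {e, b, c}" "e \<noteq> b" "e \<noteq> c" using B(1) by auto
  show thesis
  proof (rule that[of b c])
    show "b \<in> V" "c \<in> V" using B(2) Beq by auto
    fix v assume "v \<in> V"
    then obtain r where "v - scale r e \<in> span {b, c}"
      using B(4) Beq(1) by (auto simp: span_insert[of e])
    then obtain s t where "v - scale r e = scale s b + scale t c" by (auto simp: span2_iff)
    then have "v = scale r e + scale s b + scale t c" by (simp add: algebra_simps)
    then show "\<exists>r s t. v = scale r e + scale s b + scale t c" by blast
  next
    fix r s t assume *: "scale r e + scale s b + scale t c = 0"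
    define u where "u = (\<lambda>x. if x = e then r else if x = b then s else t)"
    have "(\<Sum>x\<in>B. scale (u x) x) = 0"
      using * bc(2) Beq by (simp add: u_def add.assoc)
    moreover have "finite B" using Beq(1) by simp
    ultimately have "\<forall>x\<in>B. u x = 0" using B(3) by (auto simp: independent_explicit_finite_subsets)
    then show "r = 0 \<and> s = 0 \<and> t = 0" using Beq bc(2) by (auto simp: u_def split: if_splits)
  qed
qed

lemma dim_eq_3_obtain_nonzero:
  assumes "dim V = 3"
  obtains e where "e \<in> V" "e \<noteq> 0"
proof -
  have "\<not> V \<subseteq> {0}"
  proof
    assume "V \<subseteq> {0}"
    then have "dim V = 0"
      by (metis basis_card_eq_dim card.empty empty_subsetI independent_empty span_empty)
    then show False using assms by simp
  qed
  then show thesis using that by blast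
qed

text \<open>The dual form of the theorem of Jamison and Brouwer--Schrijver on blocking sets of the affine
  plane.\<close>

lemma length_ge_if_subspaces_isolate_point:
  assumes fin: "finite (UNIV :: 'a set)" and V: "subspace V" "dim V = 3"
    and us: "\<And>U. U \<in> set us \<Longrightarrow> subspace U"
    and x: "x \<in> subspaces_of_dim scale V 1"
    and iso: "{y\<in>subspaces_of_dim scale V 1. \<forall>U\<in>set us. \<not> y \<subseteq> U} = {x}"
  shows "2 * CARD('a) - 1 \<le> length us"
proof -
  obtain e where e: "e \<in> V" "e \<noteq> 0" "x = span {e}"
    using x unfolding subspaces_of_dim_1_iff[OF V(1)] by blast
  obtain b c where bc: "b \<in> V" "c \<in> V"
    "\<And>r s t. scale r e + scale s b + scale t c = 0 \<Longrightarrow> r = 0 \<and> s = 0 \<and> t = 0"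
    using extend_to_basis3[OF V e(1,2)] by metis
  have cover: "\<exists>U\<in>set us. v \<in> U" if v: "v \<in> V" "v \<notin> span {e}" for v
  proof -
    have "v \<noteq> 0" using v(2) span_zero by blast
    then have "span {v} \<in> subspaces_of_dim scale V 1"
      using v(1) unfolding subspaces_of_dim_1_iff[OF V(1)] by blast
    moreover have "span {v} \<noteq> x" using v(2) e(3) span_base[of v "{v}"] by auto
    ultimately obtain U where "U \<in> set us" "span {v} \<subseteq> U" using iso by blast
    then show ?thesis using span_base[of v "{v}"] by blast
  qed
  have "e \<notin> U" if "U \<in> set us" for U
    using iso that span_minimal[of "{e}" U] us[OF that] e(3) by auto
  then have "\<forall>U\<in>set us. \<exists>f. (\<forall>x y. f (x + y) = f x + f y) \<and>
      (\<forall>c x. f (scale c x) = c * f x) \<and> (\<forall>x\<in>U. f x = 0) \<and> f e = 1"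
    using functional_separating_subspace us by metis
  then obtain f where "\<forall>U\<in>set us. (\<forall>x y. f U (x + y) = f U x + f U y) \<and>
      (\<forall>c x. f U (scale c x) = c * f U x) \<and> (\<forall>x\<in>U. f U x = 0) \<and> f U e = 1"
    by (auto dest: bchoice)
  then have f_add: "\<And>U x y. U \<in> set us \<Longrightarrow> f U (x + y) = f U x + f U y"
    and f_scale: "\<And>U c x. U \<in> set us \<Longrightarrow> f U (scale c x) = c * f U x"
    and f_zero: "\<And>U x. U \<in> set us \<Longrightarrow> x \<in> U \<Longrightarrow> f U x = 0"
    and f_e: "\<And>U. U \<in> set us \<Longrightarrow> f U e = 1"
    by blast+
  \<comment> \<open>Hence some query contains \<open>b\<close>; so \<open>us\<close> is nonempty and
    a first query \<open>U0\<close> can be split off.\<close>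
  have "b \<notin> span {e}"
  proof
    assume "b \<in> span {e}"
    then obtain k where "b = scale k e" by (auto simp: span_singleton)
    then show False using bc(3)[of "- k" 1 0] by simp
  qed
  then obtain U0 us' where us_eq: "us = U0 # us'" using cover[of b] bc(1) by (cases us) auto
  let ?g = "f U0"
  \<comment> \<open>Shifting \<open>b\<close> and \<open>c\<close> along \<open>e\<close> puts them
    into the kernel of \<open>?g\<close>. The vectors \<open>s b' + t c' + e\<close> then lie in the
    affine plane \<open>?g = 1\<close>, with \<open>e\<close> as origin.\<close>
  define b' where "b' = b + scale (- ?g b) e"
  define c' where "c' = c + scale (- ?g c) e"
  have "2 * (CARD('a) - 1) \<le> length us'"
  proof (rule length_ge_if_prod_affine_isolates_0[OF fin, where a = "\<lambda>U. f U b'" and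
        b = "\<lambda>U. f U c'" and c = "\<lambda>U. f U e"])
    show "f U e \<noteq> 0" if "U \<in> set us'" for U using f_e[of U] that us_eq by simp
    fix s t :: 'a assume st: "(s, t) \<noteq> (0, 0)"
    define v where "v = scale s b' + scale t c' + e"
    have fv: "f U v = f U b' * s + f U c' * t + f U e" if "U \<in> set us" for U
      using that by (simp add: v_def f_add f_scale mult.commute)
    have "v \<in> V"
      unfolding v_def b'_def c'_def using V(1) bc(1,2) e(1) by (intro subspace_add subspace_scale)
    moreover have "v \<notin> span {e}"
    proof
      assume "v \<in> span {e}"
      then obtain k where "v = scale k e" by (auto simp: span_singleton)
      \<comment> \<open>The shifts change only the coefficient of \<open>e\<close>; those of
        \<open>b\<close> and \<open>c\<close> are still \<open>s\<close> and \<open>t\<close>, which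
        would both have to vanish.\<close>
      then have "scale (1 - k - s * ?g b - t * ?g c) e + scale s b + scale t c = 0"
        by (simp add: v_def b'_def c'_def algebra_simps)
      then show False using bc(3) st by blast
    qed
    ultimately obtain U where U: "U \<in> set us" "v \<in> U" using cover by blast
    have "U0 \<in> set us" using us_eq by simp
    \<comment> \<open>So \<open>U0\<close> misses the whole affine plane, and the query that
      contains \<open>v\<close> must belong to \<open>us'\<close>.\<close>
    then have "?g v = 1"
      by (simp add: fv b'_def c'_def f_add f_scale f_e del: scale_minus_left add_uminus_conv_diff)
    then have "U \<noteq> U0" using f_zero[of U0 v] U us_eq by auto
    then have "U \<in> set us'" using U(1) us_eq by simp
    then show "\<exists>U\<in>set us'. f U b' * s + f U c' * t + f U e = 0"
      using f_zero[OF U] fv[OF U(1)] by auto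
  qed
  \<comment> \<open>Adding \<open>U0\<close> to the \<open>2(q - 1)\<close> queries of
    \<open>us'\<close> gives \<open>2q - 1\<close>.\<close>
  then show ?thesis using us_eq by simp
qed

section \<open>The exact value for PG(2,q) and for search by subspaces\<close>

lemma subspace_search_number_ge:
  assumes "finite (UNIV :: 'a set)" "subspace V" "dim V = 3"
  shows "enat (2 * CARD('a) - 1) \<le> subspace_search_number scale V"
  unfolding subspace_search_number_def
proof (rule adaptive_search_number_ge)
  obtain e where "e \<in> V" "e \<noteq> 0" using dim_eq_3_obtain_nonzero assms(3) by blast
  then show "subspaces_of_dim scale V 1 \<noteq> {}"
    using subspaces_of_dim_1_iff[OF assms(2)] by blast
  show "2 * CARD('a) - 1 \<le> length us"
    if "x \<in> subspaces_of_dim scale V 1" "set us \<subseteq> {U. subspace U \<and> U \<subseteq> V}"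
      "{y\<in>subspaces_of_dim scale V 1. \<forall>U\<in>set us. \<not> y \<subseteq> U} = {x}" for x us
    using length_ge_if_subspaces_isolate_point[OF assms _ that(1,3)] that(2) by blast
qed

text \<open>Points and lines of the plane are themselves subspaces of \<open>V\<close>;
  \<open>case_sum id id\<close> forgets which of the two a query was.\<close>

lemma subspace_search_number_le_PG:
  assumes "subspace V"
  shows "subspace_search_number scale V \<le> PG_search_number scale V"
  unfolding subspace_search_number_def PG_search_number_def plane_search_number_def
  by (rule adaptive_search_number_map_queries[of "case_sum id id"])
    (auto simp: subspaces_of_dim_1_subset_iff[OF assms], auto simp: subspaces_of_dim_def)

text \<open>The pencil strategy at \<open>span {e}\<close>, carried out in coordinates rather than
  through the axioms of a projective plane.\<close>

lemma PG_search_number_le: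
  assumes fin: "finite (UNIV :: 'a set)" and V: "subspace V" "dim V = 3"
  shows "PG_search_number scale V \<le> enat (2 * CARD('a) - 1)"
proof -
  obtain e where e: "e \<in> V" "e \<noteq> 0" using dim_eq_3_obtain_nonzero V(2) by blast
  obtain b c where bc: "b \<in> V" "c \<in> V"
    "\<And>v. v \<in> V \<Longrightarrow> \<exists>r s t. v = scale r e + scale s b + scale t c"
    "\<And>r s t. scale r e + scale s b + scale t c = 0 \<Longrightarrow> r = 0 \<and> s = 0 \<and> t = 0"
    using extend_to_basis3[OF V e] by metis
  \<comment> \<open>One direction for each point of the line \<open>span {b, c}\<close>, normalised
    to \<open>c\<close> or \<open>b + s c\<close>; the planes \<open>span {e, d}\<close> are the
    lines of the pencil.\<close>
  define D where "D = insert c (range (\<lambda>s. b + scale s c))"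
  have D: "d \<in> V" "d \<notin> span {e}" if d: "d \<in> D" for d
  proof -
    show "d \<in> V" using d bc(1,2) V(1) by (auto simp: D_def subspace_add subspace_scale)
    show "d \<notin> span {e}"
    proof
      assume "d \<in> span {e}"
      then obtain k where k: "d = scale k e" by (auto simp: span_singleton)
      consider "d = c" | s where "d = b + scale s c" using d unfolding D_def by blast
      then show False
      proof cases
        case 1
        then show False using bc(4)[of "- k" 0 1] k by simp
      next
        case 2
        then show False using bc(4)[of "- k" 1 s] k by (simp add: algebra_simps)
      qed
    qed
  qed
  have cover: "\<exists>d\<in>D. v \<in> span {e, d}" if V_v: "v \<in> V" for v
  proof -
    obtain r s t where v: "v = scale r e + scale s b + scale t c" using bc(3)[OF V_v] by blast
    show ?thesis
    proof (cases "s = 0")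
      case True
      then show ?thesis using v by (auto simp: D_def span2_iff)
    next
      case False
      then have "v = scale r e + scale s (b + scale (t / s) c)"
        using v by (simp add: algebra_simps)
      then have "v \<in> span {e, b + scale (t / s) c}" unfolding span2_iff by blast
      then show ?thesis by (auto simp: D_def)
    qed
  qed
  \<comment> \<open>A vector of \<open>span {e, d}\<close> outside \<open>span {e}\<close> has a
    nonzero coefficient at \<open>d\<close>, which can be scaled to 1. So at most
    \<open>CARD('a)\<close> points besides \<open>span {e}\<close> lie on such a line.\<close>
  have line_points: "x \<in> range (\<lambda>s. span {d + scale s e})"
    if x: "x \<in> subspaces_of_dim scale V 1" "x \<noteq> span {e}" "x \<subseteq> span {e, d}" for x d
  proof -
    obtain v where v: "v \<noteq> 0" "x = span {v}" using x(1) unfolding subspaces_of_dim_1_iff[OF V(1)] by blast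
    then have "v \<in> span {e, d}" using x(3) span_base[of v "{v}"] by blast
    then obtain s t where st: "v = scale s e + scale t d" by (auto simp: span2_iff)
    have "t \<noteq> 0"
    proof
      assume "t = 0"
      then have "v \<in> span {e}" using st by (auto simp: span_singleton)
      then have "span {v} \<subseteq> span {e}" by (simp add: span_minimal)
      then show False using span_singleton_subset_imp_eq[OF v(1)] v(2) x(2) by blast
    qed
    then have "v = scale t (d + scale (s / t) e)" using st by (simp add: algebra_simps)
    then have "v \<in> span {d + scale (s / t) e}" by (auto simp: span_singleton)
    then have "span {v} \<subseteq> span {d + scale (s / t) e}" by (simp add: span_minimal)
    then show ?thesis using span_singleton_subset_imp_eq[OF v(1)] v(2) by blast
  qed
  have "card {0, 1 :: 'a} \<le> CARD('a)" using fin by (intro card_mono) auto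
  then have "2 \<le> CARD('a)" by simp
  have "finite D" using fin by (simp add: D_def)
  have "card D \<le> Suc (card (range (\<lambda>s. b + scale s c)))"
    unfolding D_def by (rule card_insert_le_m1) simp_all
  also have "\<dots> \<le> Suc CARD('a)" using card_image_le[OF fin] by simp
  finally have "card D \<le> Suc CARD('a)" .
  let ?F = "(\<lambda>d. Inr (span {e, d})) ` D :: ('b set + 'b set) set"
  show ?thesis
    unfolding PG_search_number_def plane_search_number_def
  proof (rule adaptive_search_number_pencil_le[where F = ?F and p = "span {e}"])
    show "card ?F \<le> Suc CARD('a)"
      using card_image_le[OF \<open>finite D\<close>] \<open>card D \<le> Suc CARD('a)\<close> le_trans by blast
    show "?F \<noteq> {}" by (simp add: D_def)
    show "?F \<subseteq> subspaces_of_dim scale V 1 <+> subspaces_of_dim scale V 2"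
    proof -
      have "span {e, d} \<in> subspaces_of_dim scale V 2" if "d \<in> D" for d
      proof -
        have "d \<noteq> e" using D(2)[OF that] span_base[of e "{e}"] by auto
        moreover have "independent {d, e}"
          using D(2)[OF that] e(2) \<open>d \<noteq> e\<close> by (simp add: independent_insert)
        ultimately have "dim (span {d, e}) = 2" by (subst dim_span_eq_card_independent) auto
        moreover have "span {d, e} \<subseteq> V"
          using D(1)[OF that] e(1) V(1) by (intro span_minimal) auto
        ultimately show ?thesis by (simp add: subspaces_of_dim_def insert_commute)
      qed
      then show ?thesis by auto
    qed
    show "case l of Inl a \<Rightarrow> span {e} = a | Inr l \<Rightarrow> span {e} \<subseteq> l" if l: "l \<in> ?F" for l
    proof -
      obtain d where "l = Inr (span {e, d})" using l by blast
      moreover have "span {e} \<subseteq> span {e, d}" by (rule span_mono) auto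
      ultimately show ?thesis by simp
    qed
    show "\<exists>l\<in>?F. case l of Inl a \<Rightarrow> x = a | Inr l \<Rightarrow> x \<subseteq> l"
      if x: "x \<in> subspaces_of_dim scale V 1" for x
    proof -
      obtain v where v: "v \<in> V" "x = span {v}" using x unfolding subspaces_of_dim_1_iff[OF V(1)] by blast
      obtain d where "d \<in> D" "v \<in> span {e, d}" using cover[OF v(1)] by blast
      moreover from this have "span {v} \<subseteq> span {e, d}" by (intro span_minimal) auto
      ultimately show ?thesis using v(2) by (intro bexI[of _ "Inr (span {e, d})"]) auto
    qed
    show "finite {x\<in>subspaces_of_dim scale V 1.
          x \<noteq> span {e} \<and> (case l of Inl a \<Rightarrow> x = a | Inr l \<Rightarrow> x \<subseteq> l)} \<and>
        card {x\<in>subspaces_of_dim scale V 1.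
          x \<noteq> span {e} \<and> (case l of Inl a \<Rightarrow> x = a | Inr l \<Rightarrow> x \<subseteq> l)} \<le> CARD('a)"
      (is "finite ?S \<and> card ?S \<le> _") if l: "l \<in> ?F" for l
    proof -
      obtain d where "l = Inr (span {e, d})" using l by blast
      then have sub: "?S \<subseteq> range (\<lambda>s. span {d + scale s e})" using line_points by auto
      have fin': "finite (range (\<lambda>s. span {d + scale s e}))" using fin by simp
      have "card ?S \<le> card (range (\<lambda>s. span {d + scale s e}))" using card_mono[OF fin' sub] .
      also have "\<dots> \<le> CARD('a)" using card_image_le[OF fin] .
      finally show ?thesis using finite_subset[OF sub fin'] by blast
    qed
    show "\<exists>u\<in>subspaces_of_dim scale V 1 <+> subspaces_of_dim scale V 2.
        \<forall>y\<in>subspaces_of_dim scale V 1. (case u of Inl a \<Rightarrow> y = a | Inr l \<Rightarrow> y \<subseteq> l) \<longleftrightarrow> y = x"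
      if "x \<in> subspaces_of_dim scale V 1" for x
      using that by (intro bexI[of _ "Inl x"]) auto
  qed (use \<open>2 \<le> CARD('a)\<close> \<open>finite D\<close> in auto)
qed

end

theorem theorem1p1:
  fixes q :: nat
    and P :: "'p set" and L :: "'l set" and I :: "'p \<Rightarrow> 'l \<Rightarrow> bool"
    and scale :: "'k::{field,finite} \<Rightarrow> 'v::ab_group_add \<Rightarrow> 'v" and V :: "'v set"
  shows "(projective_plane_of_order P L I q \<longrightarrow>
            plane_search_number P L I \<le> enat (2 * q - 1)) \<and>
         (primepow q \<and> CARD('k) = q \<and> vector_space scale \<and>
          module.subspace scale V \<and> vector_space.dim scale V = 3 \<longrightarrow>
            PG_search_number scale V = enat (2 * q - 1) \<and>
            subspace_search_number scale V = enat (2 * q - 1))"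
proof (intro conjI[of "_ \<longrightarrow> _"] impI)
  assume "projective_plane_of_order P L I q"
  then show "plane_search_number P L I \<le> enat (2 * q - 1)"
    by (rule plane_search_number_le)
next
  assume *: "primepow q \<and> CARD('k) = q \<and> vector_space scale \<and>
    module.subspace scale V \<and> vector_space.dim scale V = 3"
  then interpret vector_space scale by blast
  \<comment> \<open>Both values are squeezed in one chain: the lower bound holds for the larger set
    of queries, the upper bound for the smaller one.\<close>
  have "enat (2 * q - 1) \<le> subspace_search_number scale V"
    using subspace_search_number_ge[of V] * by simp
  moreover have "subspace_search_number scale V \<le> PG_search_number scale V"
    using subspace_search_number_le_PG[of V] * by simp
  moreover have "PG_search_number scale V \<le> enat (2 * q - 1)"
    using PG_search_number_le[of V] * by simp
  ultimately show "PG_search_number scale V = enat (2 * q - 1) \<and>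
      subspace_search_number scale V = enat (2 * q - 1)" by auto
qed

end
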